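(* Let $d\ge 2$, let $X=X_d$ be a finite nonempty set of labels, and let $\mathcal{P}\subseteq\mathcal{LT}(X)$ be a set of patterns. Suppose that the power series $$h(z)=1-\frac{|X_d|\,z^{d-1}}{d!}+\frac{f_{\mathcal{P}}(z)}{z}$$ has a root $\alpha>0$. Then for every $n\ge1$, $$|\mathcal{LT}_{n,\mathrm{no}\text{-}\mathcal{P}}(X)|\ \ge\ \left(\frac{(d!)^{\frac{1}{d-1}}}{|X_d|^{\frac{1}{d-1}}\,\alpha}\right)^{n-1}|\mathcal{LT}_n(X)|.$$
   Context: "$X=X_d$" means all internal vertices of trees have exactly $d$ children and are labelled by elements of the finite set $X_d$. A planar $X$-labelled rooted tree is a planar rooted tree (children ordered left to right) whose internal vertices each have $d$ children and carry a label from $X_d$, and whose leaves are labelled bijectively by $\{1,\dots,l\}$ ($l$ = number of leaves) so that, if each internal vertex is assigned the minimum label of the leaves descending from it, the numbers assigned to the children of every internal vertex increase from left to right. $\mathcal{LT}_l(X)$ is the set of such trees with $l$ leaves, $\mathcal{LT}(X)$ their union. A subtree of $T$ is a subtree $S$ rooted at an internal vertex of $T$ such that for every internal vertex of $S$ all its children in $T$ are children in $S$; its leaves carry the assigned integers, and relabelling them order-preservingly by $1,\dots,l$ gives the standardisation $\mathrm{st}(S)$. $T$ avoids $P$ if $P\neq\mathrm{st}(S)$ for all subtrees $S$. $\mathcal{LT}_{n,\mathrm{no}\text{-}\mathcal{P}}(X)$ is the set of trees with $n$ leaves avoiding every element of $\mathcal{P}$; $f_{\mathcal{P}}(z)=\sum_{l\ge1}|\mathcal{P}\cap\mathcal{LT}_l(X)|z^l/l!$.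 A root $\alpha>0$ of the power series means the series converges at $\alpha$ with value $0$. *)

theory Defs
  imports Complex_Main "HOL-Computational_Algebra.Formal_Power_Series"
begin

datatype 'x ltree = Leaf nat | Node 'x "'x ltree list"

fun leaves :: "'x ltree \<Rightarrow> nat list" where
  "leaves (Leaf i) = [i]"
| "leaves (Node x ts) = concat (map leaves ts)"

text \<open>The integer assigned to the root of a tree. The integer assigned to any other vertex is
  the one assigned to the root of the full subtree hanging from that vertex.\<close>

definition min_label :: "'x ltree \<Rightarrow> nat" where
  "min_label t = Min (set (leaves t))"

fun well_formed :: "nat \<Rightarrow> 'x set \<Rightarrow> 'x ltree \<Rightarrow> bool" where
  "well_formed d X (Leaf i) \<longleftrightarrow> True"
| "well_formed d X (Node x ts) \<longleftrightarrow>
     x \<in> X \<and> length ts = d \<and> sorted_wrt (<) (map min_label ts) \<and>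
     (\<forall>t\<in>set ts. well_formed d X t)"

definition LT :: "nat \<Rightarrow> 'x set \<Rightarrow> 'x ltree set" where
  "LT d X = {t. well_formed d X t \<and> distinct (leaves t) \<and>
                set (leaves t) = {1..length (leaves t)}}"

definition LT_n :: "nat \<Rightarrow> 'x set \<Rightarrow> nat \<Rightarrow> 'x ltree set" where
  "LT_n d X l = {t \<in> LT d X. length (leaves t) = l}"

text \<open>The full subtrees (a vertex together with all its descendants).\<close>

fun full_subtrees :: "'x ltree \<Rightarrow> 'x ltree set" where
  "full_subtrees (Leaf i) = {Leaf i}"
| "full_subtrees (Node x ts) = insert (Node x ts) (\<Union>t\<in>set ts. full_subtrees t)"

text \<open>\<open>truncation S U\<close>: \<open>S\<close> arises from \<open>U\<close> by turning some vertices into leaves, which keep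
  their assigned integers. Vertices that stay internal keep all their children. A leaf of \<open>U\<close> is
  covered by the first rule, since it is its own assigned integer.\<close>

inductive truncation :: "'x ltree \<Rightarrow> 'x ltree \<Rightarrow> bool" where
  cut: "truncation (Leaf (min_label U)) U"
| keep: "list_all2 truncation ss us \<Longrightarrow> truncation (Node x ss) (Node x us)"

text \<open>The root of a subtree is an internal vertex of the subtree itself, so the one-vertex tree
  never occurs as a subtree.\<close>

definition subtree :: "'x ltree \<Rightarrow> 'x ltree \<Rightarrow> bool" where
  "subtree S T \<longleftrightarrow> (\<exists>x ss. S = Node x ss) \<and> (\<exists>U\<in>full_subtrees T. truncation S U)"

fun relabel :: "(nat \<Rightarrow> nat) \<Rightarrow> 'x ltree \<Rightarrow> 'x ltree" where
  "relabel g (Leaf i) = Leaf (g i)"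
| "relabel g (Node x ts) = Node x (map (relabel g) ts)"

text \<open>Standardisation: the order-preserving relabelling sends a leaf label to its rank.\<close>

definition st :: "'x ltree \<Rightarrow> 'x ltree" where
  "st S = relabel (\<lambda>i. card {j \<in> set (leaves S). j \<le> i}) S"

definition avoids :: "'x ltree \<Rightarrow> 'x ltree \<Rightarrow> bool" where
  "avoids T p \<longleftrightarrow> (\<forall>S. subtree S T \<longrightarrow> p \<noteq> st S)"

definition LT_avoiding :: "nat \<Rightarrow> 'x set \<Rightarrow> 'x ltree set \<Rightarrow> nat \<Rightarrow> 'x ltree set" where
  "LT_avoiding d X P n = {T \<in> LT_n d X n. \<forall>p\<in>P. avoids T p}"

definition f_series :: "nat \<Rightarrow> 'x set \<Rightarrow> 'x ltree set \<Rightarrow> real fps" where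
  "f_series d X P =
     Abs_fps (\<lambda>l. if l \<ge> 1 then real (card (P \<inter> LT_n d X l)) / fact l else 0)"

definition h_series :: "nat \<Rightarrow> 'x set \<Rightarrow> 'x ltree set \<Rightarrow> real fps" where
  "h_series d X P =
     1 - fps_const (real (card X) / fact d) * fps_X ^ (d - 1) + f_series d X P / fps_X"

definition fps_root :: "real fps \<Rightarrow> real \<Rightarrow> bool" where
  "fps_root F a \<longleftrightarrow> (\<lambda>k. fps_nth F k * a ^ k) sums 0"

end

theory Submission
  imports Defs "HOL-Library.Infinite_Set"
begin

text \<open>
  Let \<open>A\<close> and \<open>F\<close> be the exponential generating functions of the avoiding trees and of all trees,
  and \<open>k\<close> the number of labels. Attach \<open>d\<close> avoiding trees to a new root: if the result is not
  avoiding, then a pattern occurs at its root, with avoiding trees hanging from the leaves of the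
  occurrence. This is a Golod--Shafarevich inequality \<open>k A\<^sup>d / d! \<le> A - z + f(A)\<close>, that is,
  \<open>z \<le> A h(A)\<close>, for all coefficients. As \<open>h\<close> has a root \<open>\<alpha>\<close>, it factors as
  \<open>h = (1 - (z/\<alpha>)\<^sup>d\<^sup>-\<^sup>1) q\<close>; since all coefficients of \<open>h\<close> but the one at \<open>z\<^sup>d\<^sup>-\<^sup>1\<close> are
  nonnegative, \<open>q\<close> has constant term 1 and no other positive coefficient, so the factor \<open>q(A)\<close> can
  be cancelled: \<open>A \<ge> z + A\<^sup>d / \<alpha>\<^sup>d\<^sup>-\<^sup>1\<close>. The rescaled series \<open>B(z) = F(b z) / b\<close> with
  \<open>b\<^sup>d\<^sup>-\<^sup>1 = d! / (k \<alpha>\<^sup>d\<^sup>-\<^sup>1)\<close> solves \<open>B = z + B\<^sup>d / \<alpha>\<^sup>d\<^sup>-\<^sup>1\<close>, whence \<open>A \<ge> B\<close>.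
\<close>

section \<open>Trees and relabelling\<close>

lemma leaves_nonempty: "well_formed d X t \<Longrightarrow> d \<ge> 1 \<Longrightarrow> leaves t \<noteq> []"
proof (induction t)
  case (Node x ts)
  then obtain u us where "ts = u # us" by (cases ts) auto
  with Node show ?case by auto
qed auto

text \<open>Summing leaf count minus 1 over the \<open>d\<close> children gives the leaf count minus
  \<open>d\<close>; adding \<open>d - 1\<close> gives the claim. The integers avoid truncated
  subtraction. This confines \<open>h\<close> to exponents divisible by
  \<open>d - 1\<close>.\<close>

lemma leaf_count_cong:
  assumes "well_formed d X t" "d \<ge> 1"
  shows "int (d - 1) dvd int (length (leaves t)) - 1"
  using assms
proof (induction t)
  case (Node x ts)
  have sum: "int (length (concat (map leaves us))) - int (length us)
      = (\<Sum>t\<leftarrow>us. int (length (leaves t)) - 1)" for us :: "'a ltree list"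
    by (induction us) auto
  have "int (d - 1) dvd (\<Sum>t\<leftarrow>us. int (length (leaves t)) - 1)" if "set us \<subseteq> set ts" for us
    using that Node by (induction us) auto
  then have "int (d - 1) dvd int (length (concat (map leaves ts))) - int (length ts)"
    by (simp only: sum order_refl)
  then have "int (d - 1) dvd int (length (concat (map leaves ts))) - int (length ts) + int (d - 1)"
    by simp
  with Node.prems show ?case by (simp add: of_nat_diff algebra_simps)
qed auto

lemma min_label_in: "leaves t \<noteq> [] \<Longrightarrow> min_label t \<in> set (leaves t)"
  by (simp add: min_label_def)

lemma min_label_le: "i \<in> set (leaves t) \<Longrightarrow> min_label t \<le> i"
  by (simp add: min_label_def)

lemma leaves_relabel [simp]: "leaves (relabel g t) = map g (leaves t)"
  by (induction t) (auto simp: map_concat intro!: arg_cong[where f = concat])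

lemma relabel_relabel: "relabel f (relabel g t) = relabel (f \<circ> g) t"
  by (induction t) auto

lemma relabel_cong: "(\<And>i. i \<in> set (leaves t) \<Longrightarrow> f i = g i) \<Longrightarrow> relabel f t = relabel g t"
  by (induction t) auto

lemma relabel_id: "(\<And>i. i \<in> set (leaves t) \<Longrightarrow> f i = i) \<Longrightarrow> relabel f t = t"
  by (induction t) (auto intro: map_idI)

lemma min_label_relabel:
  assumes "leaves t \<noteq> []" "strict_mono_on (set (leaves t)) g"
  shows "min_label (relabel g t) = g (min_label t)"
  unfolding min_label_def[of "relabel g t"]
proof (rule Min_eqI)
  show "g (min_label t) \<le> y" if "y \<in> set (leaves (relabel g t))" for y
    using that assms min_label_in[OF assms(1)] min_label_le
    by (auto dest: strict_mono_on_leD)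
qed (use assms min_label_in in auto)

lemma well_formed_relabel:
  assumes "well_formed d X t" "d \<ge> 1" "strict_mono_on (set (leaves t)) g"
  shows "well_formed d X (relabel g t)"
  using assms
proof (induction t)
  case (Node x ts)
  have sm: "strict_mono_on (set (leaves t)) g" if "t \<in> set ts" for t
    using Node.prems(3) that by (auto intro: monotone_on_subset)
  have ml: "min_label (relabel g t) = g (min_label t)" if "t \<in> set ts" for t
    using Node.prems that sm by (intro min_label_relabel leaves_nonempty[of d X]) auto
  have lin: "min_label t \<in> set (leaves (Node x ts))" if "t \<in> set ts" for t
    using Node.prems that leaves_nonempty[of d X t] min_label_in[of t] by auto
  \<comment> \<open>Stated for arbitrary lists of children, so that the induction can drop the first
    child while \<open>ml\<close> and \<open>lin\<close> remain available.\<close>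
  have "sorted_wrt (<) (map min_label (map (relabel g) us))"
    if "set us \<subseteq> set ts" "sorted_wrt (<) (map min_label us)" for us
    using that
  proof (induction us)
    case (Cons u us)
    then show ?case
      using lin by (auto simp: ml subset_iff intro!: strict_mono_onD[OF Node.prems(3)])
  qed simp
  with Node.prems Node.IH sm show ?case by simp
qed auto

section \<open>Full subtrees, truncations and avoidance under increasing relabellings\<close>

lemma well_formed_full_subtree:
  "u \<in> full_subtrees t \<Longrightarrow> well_formed d X t \<Longrightarrow> well_formed d X u"
  by (induction t) auto

lemma leaves_full_subtree: "u \<in> full_subtrees t \<Longrightarrow> set (leaves u) \<subseteq> set (leaves t)"
  by (induction t) fastforce+

lemma full_subtrees_refl: "t \<in> full_subtrees t"
  by (cases t) auto

lemma full_subtrees_trans: "u \<in> full_subtrees t \<Longrightarrow> v \<in> full_subtrees u \<Longrightarrow> v \<in> full_subtrees t"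
  by (induction t) auto

lemma full_subtrees_relabel: "full_subtrees (relabel g t) = relabel g ` full_subtrees t"
  by (induction t) auto

lemma truncation_relabel:
  assumes "truncation S U" "well_formed d X U" "d \<ge> 1" "strict_mono_on (set (leaves U)) g"
  shows "truncation (relabel g S) (relabel g U)"
  using assms
proof (induction S U rule: truncation.induct)
  case (cut U)
  then show ?case
    by (auto simp flip: min_label_relabel[OF leaves_nonempty[of d X]] intro: truncation.cut)
next
  case (keep ss us x)
  have "strict_mono_on (set (leaves u)) g" if "u \<in> set us" for u
    using keep.prems(3) that by (auto intro: monotone_on_subset)
  with keep show ?case
    by (auto intro!: truncation.keep simp: list_all2_conv_all_nth)
qed

text \<open>The integer of a cut vertex is the label of one of the leaves below it.\<close>

lemma truncation_leaves:
  assumes "truncation S U" "well_formed d X U" "d \<ge> 1"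
  shows "set (leaves S) \<subseteq> set (leaves U)"
  using assms
proof (induction S U rule: truncation.induct)
  case (cut U)
  then show ?case using leaves_nonempty min_label_in by fastforce
next
  case (keep ss us x)
  then show ?case
    by (fastforce simp: list_all2_conv_all_nth in_set_conv_nth)
qed

text \<open>Increasing maps preserve ranks.\<close>

lemma st_relabel:
  assumes "strict_mono_on (set (leaves S)) g"
  shows "st (relabel g S) = st S"
proof -
  let ?L = "set (leaves S)"
  have "card {j \<in> g ` ?L. j \<le> g i} = card {j \<in> ?L. j \<le> i}" if "i \<in> ?L" for i
  proof -
    have "{j \<in> g ` ?L. j \<le> g i} = g ` {j \<in> ?L. j \<le> i}"
      using that strict_mono_on_less_eq[OF assms] by auto
    moreover have "inj_on g {j \<in> ?L. j \<le> i}"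
      using strict_mono_on_imp_inj_on[OF assms] by (rule inj_on_subset) auto
    ultimately show ?thesis by (simp add: card_image)
  qed
  then show ?thesis
    by (auto simp: st_def relabel_relabel intro!: relabel_cong)
qed

lemma subtree_relabel:
  assumes "subtree S T" "well_formed d X T" "d \<ge> 1" "strict_mono_on (set (leaves T)) g"
  shows "subtree (relabel g S) (relabel g T)" "st (relabel g S) = st S"
proof -
  obtain x ss U where S: "S = Node x ss" "U \<in> full_subtrees T" "truncation S U"
    using assms(1) by (auto simp: subtree_def)
  have U: "well_formed d X U" "set (leaves U) \<subseteq> set (leaves T)"
    using S assms well_formed_full_subtree leaves_full_subtree by blast+
  have mU: "strict_mono_on (set (leaves U)) g"
    using U assms(4) by (auto intro: monotone_on_subset)
  show "subtree (relabel g S) (relabel g T)"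
    using truncation_relabel[OF S(3) U(1) assms(3) mU] S(1,2)
    by (auto simp: subtree_def full_subtrees_relabel)
  show "st (relabel g S) = st S"
    by (rule st_relabel) (use truncation_leaves[OF S(3) U(1) assms(3)] mU in \<open>auto intro: monotone_on_subset\<close>)
qed

lemma avoids_full_subtree: "avoids T p \<Longrightarrow> U \<in> full_subtrees T \<Longrightarrow> avoids U p"
  unfolding avoids_def subtree_def using full_subtrees_trans by blast

lemma avoids_Leaf: "avoids (Leaf i) p"
  by (auto simp: avoids_def subtree_def elim: truncation.cases)

text \<open>An occurrence in the relabelled tree is carried back by the inverse of \<open>g\<close>,
  which is increasing on the new labels, and keeps its standardisation.\<close>

lemma avoids_relabel:
  assumes "avoids T p" "well_formed d X T" "d \<ge> 1" "strict_mono_on (set (leaves T)) g"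
  shows "avoids (relabel g T) p"
  unfolding avoids_def
proof (intro allI impI)
  fix S assume S: "subtree S (relabel g T)"
  define g' where "g' = inv_into (set (leaves T)) g"
  have inj: "inj_on g (set (leaves T))"
    using assms(4) by (rule strict_mono_on_imp_inj_on)
  have sm: "strict_mono_on (g ` set (leaves T)) g'"
    using strict_mono_on_less[OF assms(4)] inj
    by (auto simp: strict_mono_on_def g'_def)
  have T: "relabel g' (relabel g T) = T"
    using inj by (auto simp: relabel_relabel g'_def intro!: relabel_id)
  have "subtree (relabel g' S) T" "st (relabel g' S) = st S"
    using subtree_relabel[OF S well_formed_relabel[OF assms(2-4)] assms(3), of g'] sm T by auto
  with assms(1) show "p \<noteq> st S" by (auto simp: avoids_def)
qed

section \<open>Grafting\<close>

text \<open>The operation that undoes a truncation: it restores the trees that were cut off.\<close>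

fun graft :: "(nat \<Rightarrow> 'x ltree) \<Rightarrow> 'x ltree \<Rightarrow> 'x ltree" where
  "graft \<phi> (Leaf i) = \<phi> i"
| "graft \<phi> (Node x ts) = Node x (map (graft \<phi>) ts)"

lemma graft_cong: "(\<And>i. i \<in> set (leaves t) \<Longrightarrow> \<phi> i = \<psi> i) \<Longrightarrow> graft \<phi> t = graft \<psi> t"
  by (induction t) auto

lemma graft_relabel: "graft \<phi> (relabel g t) = graft (\<phi> \<circ> g) t"
  by (induction t) auto

lemma leaves_graft: "leaves (graft \<phi> t) = concat (map (\<lambda>i. leaves (\<phi> i)) (leaves t))"
proof (induction t)
  case (Node x ts)
  then show ?case by (induction ts) auto
qed auto

lemma distinct_concat_nth_eq:
  assumes "distinct (concat xss)" "j < length xss" "k < length xss" "i \<in> set (xss ! j)" "i \<in> set (xss ! k)"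
  shows "j = k"
proof -
  have "\<not> j < k" if "k < length xss" "i \<in> set (xss ! j)" "i \<in> set (xss ! k)" for j k
  proof
    assume "j < k"
    have "distinct (concat (take k xss @ xss ! k # drop (Suc k) xss))"
      using assms(1) that(1) by (simp only: id_take_nth_drop[symmetric])
    then have "set (concat (take k xss)) \<inter> set (xss ! k) = {}" by auto
    moreover have "xss ! j \<in> set (take k xss)"
      using \<open>j < k\<close> that(1) by (auto simp: in_set_conv_nth intro!: exI[of _ j])
    ultimately show False using that(2,3) by auto
  qed
  with assms show ?thesis by (meson linorder_neqE_nat)
qed

text \<open>Each leaf of \<open>S\<close> is replaced by the tree cut off there, whose least label
  is the label that the cut gave to the leaf. Distinct labels make this tree a function of the
  label.\<close>

lemma truncation_graft:
  assumes "truncation S U" "well_formed d X U" "d \<ge> 1" "distinct (leaves U)"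
  shows "\<exists>\<phi>. U = graft \<phi> S \<and> (\<forall>i\<in>set (leaves S). min_label (\<phi> i) = i)"
  using assms
proof (induction S U rule: truncation.induct)
  case (cut U)
  then show ?case by (intro exI[of _ "\<lambda>_. U"]) auto
next
  case (keep ss us x)
  have len: "length ss = length us" using keep by (auto simp: list_all2_lengthD)
  have tr: "truncation (ss ! j) (us ! j)" if "j < length us" for j
    using keep that by (auto simp: list_all2_conv_all_nth)
  have "distinct (leaves (us ! j))" if "j < length us" for j
    using keep.prems(3) that by (auto simp: distinct_concat_iff)
  then have "\<forall>j<length us. \<exists>\<phi>. us ! j = graft \<phi> (ss ! j) \<and> (\<forall>i\<in>set (leaves (ss ! j)). min_label (\<phi> i) = i)"
    using keep by (auto simp: list_all2_conv_all_nth)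
  then obtain \<Phi> where \<Phi>: "\<And>j. j < length us \<Longrightarrow> us ! j = graft (\<Phi> j) (ss ! j)"
    "\<And>j i. j < length us \<Longrightarrow> i \<in> set (leaves (ss ! j)) \<Longrightarrow> min_label (\<Phi> j i) = i"
    by metis
  have sub: "set (leaves (ss ! j)) \<subseteq> set (leaves (us ! j))" if "j < length us" for j
    by (rule truncation_leaves[of _ _ d X]) (use that tr keep.prems in auto)
  have disj: "j = k" if "j < length us" "k < length us" "i \<in> set (leaves (ss ! j))" "i \<in> set (leaves (ss ! k))" for i j k
    by (rule distinct_concat_nth_eq[of "map leaves us"]) (use that sub keep.prems(3) in auto)
  \<comment> \<open>By \<open>disj\<close> only one child of the truncation owns the label
    \<open>i\<close>, so the graftings of the children glue to one function.\<close>
  define \<phi> where "\<phi> i = \<Phi> (THE j. j < length us \<and> i \<in> set (leaves (ss ! j))) i" for i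
  have \<phi>: "\<phi> i = \<Phi> j i" if "j < length us" "i \<in> set (leaves (ss ! j))" for i j
  proof -
    have "(THE j. j < length us \<and> i \<in> set (leaves (ss ! j))) = j"
      using that disj by blast
    then show ?thesis by (simp add: \<phi>_def)
  qed
  have "us ! j = graft \<phi> (ss ! j)" if "j < length us" for j
    using \<Phi>(1)[OF that] graft_cong[of "ss ! j" \<phi> "\<Phi> j"] \<phi>[OF that] by simp
  then have "us = map (graft \<phi>) ss"
    using len by (auto intro: nth_equalityI)
  moreover have "min_label (\<phi> i) = i" if "i \<in> set (leaves s)" "s \<in> set ss" for i s
    using that \<phi> \<Phi>(2) len by (metis in_set_conv_nth)
  ultimately show ?case by (intro exI[of _ \<phi>]) auto
qed

section \<open>Sorted forests of avoiding trees\<close>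

lemma length_le_leaf_count:
  "(\<And>t. t \<in> set ts \<Longrightarrow> leaves t \<noteq> []) \<Longrightarrow> length ts \<le> length (concat (map leaves ts))"
proof (induction ts)
  case (Cons t ts)
  then have "length (leaves t) \<ge> 1" by (simp add: Suc_le_eq)
  with Cons show ?case by fastforce
qed simp

lemma sum_subsets_card:
  assumes "finite K"
  shows "(\<Sum>S\<in>Pow K. f (card S)) = (\<Sum>j\<le>card K. (card K choose j) * (f j :: nat))"
proof -
  have "(\<Sum>S\<in>Pow K. f (card S)) = (\<Sum>j\<le>card K. \<Sum>S\<in>{S \<in> Pow K. card S = j}. f (card S))"
    using assms by (intro sum.group[symmetric]) (auto intro: card_mono)
  also have "\<dots> = (\<Sum>j\<le>card K. (card K choose j) * f j)"
    using assms n_subsets[OF assms] by (intro sum.cong) (auto simp: Pow_def)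
  finally show ?thesis .
qed

text \<open>Used twice in the end: with the given patterns, and with \<open>P = {}\<close>, where
  the avoiding trees are all trees.\<close>

locale tree_patterns =
  fixes d :: nat and X :: "'x set" and P :: "'x ltree set"
  assumes d: "d \<ge> 2" and finite_X: "finite X"
begin

definition trees :: "nat set \<Rightarrow> 'x ltree set" where
  "trees L = {t. well_formed d X t \<and> distinct (leaves t) \<and> set (leaves t) = L \<and> (\<forall>p\<in>P. avoids t p)}"

text \<open>Sorting by least labels selects one list for each set of \<open>m\<close> label-disjoint
  trees. Such lists serve as the children of a root (\<open>m = d\<close>) and as the trees hanging
  from the \<open>m\<close> leaves of a pattern occurrence.\<close>

definition forests :: "nat \<Rightarrow> nat set \<Rightarrow> 'x ltree list set" where
  "forests m L = {ts. length ts = m \<and> sorted_wrt (<) (map min_label ts) \<and>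
     distinct (concat (map leaves ts)) \<and> set (concat (map leaves ts)) = L \<and>
     (\<forall>t\<in>set ts. well_formed d X t \<and> (\<forall>p\<in>P. avoids t p))}"

definition tree_count :: "nat \<Rightarrow> nat" where
  "tree_count n = card (trees {1..n})"

definition forest_count :: "nat \<Rightarrow> nat \<Rightarrow> nat" where
  "forest_count m n = card (forests m {1..n})"

section \<open>Finiteness, and independence of the label set\<close>

lemma d1: "d \<ge> 1" using d by simp

lemma nonempty: "well_formed d X t \<Longrightarrow> leaves t \<noteq> []"
  using leaves_nonempty d1 by blast

text \<open>Since \<open>d \<ge> 2\<close>, the child has a sibling, and every sibling has a
  leaf.\<close>

lemma child_smaller:
  assumes "well_formed d X (Node x ts)" "t \<in> set ts"
  shows "length (leaves t) < length (leaves (Node x ts))"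
proof -
  obtain us vs where ts: "ts = us @ t # vs" using assms(2) by (auto simp: in_set_conv_decomp)
  have "length us + length vs \<le> length (concat (map leaves us)) + length (concat (map leaves vs))"
    using assms(1) nonempty ts by (intro add_mono length_le_leaf_count) auto
  moreover have "length us + length vs \<ge> 1" using assms(1) ts d by simp
  ultimately have "1 \<le> length (concat (map leaves us)) + length (concat (map leaves vs))" by linarith
  then show ?thesis by (simp only: ts leaves.simps map_append concat_append list.map concat.simps length_append)
qed

text \<open>Induction on the leaf bound: by \<open>child_smaller\<close> the children of a node obey
  the previous bound.\<close>

lemma finite_bounded_trees:
  "finite L \<Longrightarrow> finite {t. well_formed d X t \<and> set (leaves t) \<subseteq> L \<and> length (leaves t) \<le> n}"
proof (induction n)
  case 0
  have "{t. well_formed d X t \<and> set (leaves t) \<subseteq> L \<and> length (leaves t) \<le> 0} = {}"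
    using nonempty by auto
  then show ?case by (simp only: finite.emptyI)
next
  case (Suc n)
  let ?B = "\<lambda>n. {t. well_formed d X t \<and> set (leaves t) \<subseteq> L \<and> length (leaves t) \<le> n}"
  have "?B (Suc n) \<subseteq> Leaf ` L \<union> (\<lambda>(x, ts). Node x ts) ` (X \<times> {ts. set ts \<subseteq> ?B n \<and> length ts = d})"
  proof
    fix t assume t: "t \<in> ?B (Suc n)"
    show "t \<in> Leaf ` L \<union> (\<lambda>(x, ts). Node x ts) ` (X \<times> {ts. set ts \<subseteq> ?B n \<and> length ts = d})"
    proof (cases t)
      case (Node x ts)
      have "length (leaves u) \<le> n" if "u \<in> set ts" for u
        using child_smaller[of x ts u] that t Node by auto
      then have "(x, ts) \<in> X \<times> {ts. set ts \<subseteq> ?B n \<and> length ts = d}"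
        using t Node by auto
      then show ?thesis unfolding Node by blast
    qed (use t in auto)
  qed
  moreover have "finite \<dots>"
    using Suc finite_X by (intro finite_UnI finite_imageI finite_cartesian_product finite_lists_length_eq) auto
  ultimately show ?case by (rule finite_subset)
qed

lemma finite_trees: "finite L \<Longrightarrow> finite (trees L)"
  by (rule finite_subset[OF _ finite_bounded_trees[of L "card L"]])
    (auto simp: trees_def simp flip: distinct_card)

lemma card_trees_image_le:
  assumes "finite L" "strict_mono_on L g"
  shows "card (trees L) \<le> card (trees (g ` L))"
proof (rule card_inj_on_le[of "relabel g"])
  have inj: "inj_on g L" using assms(2) by (rule strict_mono_on_imp_inj_on)
  show "inj_on (relabel g) (trees L)"
  proof (rule inj_on_inverseI)
    show "relabel (inv_into L g) (relabel g t) = t" if "t \<in> trees L" for t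
      using that inj by (auto simp: relabel_relabel trees_def intro!: relabel_id)
  qed
  show "relabel g ` trees L \<subseteq> trees (g ` L)"
    using assms inj d1 by (auto simp: trees_def distinct_map intro!: well_formed_relabel avoids_relabel)
qed (use assms finite_trees in auto)

text \<open>The increasing enumeration of \<open>L\<close> and its inverse inject the trees into
  each other in both directions.\<close>

lemma card_trees:
  assumes "finite L"
  shows "card (trees L) = tree_count (card L)"
proof -
  have eq: "card (trees L) = card (trees {..<card L})" if fin: "finite L" for L
  proof -
    obtain h where h: "bij_betw h {..<card L} L" "strict_mono_on {..<card L} h"
      using ex_bij_betw_strict_mono_card[OF fin] by blast
    let ?h' = "inv_into {..<card L} h"
    have "strict_mono_on L ?h'"
    proof (rule strict_mono_onI)
      fix r s assume rs: "r \<in> L" "s \<in> L" "r < s"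
      have "h (?h' r) < h (?h' s)" using rs h(1) by (simp add: bij_betw_inv_into_right)
      moreover have "?h' r \<in> {..<card L}" "?h' s \<in> {..<card L}"
        using rs h(1) by (meson bij_betwE bij_betw_inv_into)+
      ultimately show "?h' r < ?h' s" using strict_mono_on_less[OF h(2)] by blast
    qed
    moreover have "?h' ` L = {..<card L}" using h(1) by (meson bij_betw_imp_surj_on bij_betw_inv_into)
    ultimately have "card (trees L) \<le> card (trees {..<card L})"
      using card_trees_image_le[OF fin] by metis
    moreover have "card (trees {..<card L}) \<le> card (trees L)"
      using card_trees_image_le[OF _ h(2)] h(1) by (simp add: bij_betw_def)
    ultimately show ?thesis by simp
  qed
  show ?thesis
    using eq[OF assms] eq[of "{1..card L}"] by (simp add: tree_count_def)
qed

section \<open>Recursion for sorted forests\<close>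

lemma forests_0: "forests 0 L = (if L = {} then {[]} else {})"
  by (auto simp: forests_def)

lemma min_label_Min: "t \<in> trees L \<Longrightarrow> min_label t = Min L"
  by (auto simp: trees_def min_label_def)

lemma trees_nonempty: "t \<in> trees L \<Longrightarrow> L \<noteq> {}"
  using nonempty by (auto simp: trees_def)

text \<open>The tree containing the least label must stand first. Once its label set
  \<open>S\<close> is chosen, the other trees form any sorted forest on
  \<open>L - S\<close>.\<close>

lemma forests_Suc:
  assumes "finite L" "L \<noteq> {}"
  shows "forests (Suc m) L =
    (\<Union>S\<in>{S. S \<subseteq> L \<and> Min L \<in> S}. (\<lambda>(t, ts). t # ts) ` (trees S \<times> forests m (L - S)))"
    (is "_ = ?R")
proof (intro equalityI subsetI)
  fix us assume us: "us \<in> forests (Suc m) L"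
  then obtain t ts where [simp]: "us = t # ts" by (cases us) (auto simp: forests_def)
  let ?S = "set (leaves t)"
  have wf: "well_formed d X t" and sub: "?S \<subseteq> L" using us by (auto simp: forests_def)
  have "Min L \<in> ?S"
  proof (rule ccontr)
    assume n: "Min L \<notin> ?S"
    have "Min L \<in> L" using assms by simp
    then obtain u where u: "u \<in> set ts" "Min L \<in> set (leaves u)"
      using us n by (auto simp: forests_def)
    then have "min_label t < min_label u" "min_label u \<le> Min L"
      using us by (auto simp: forests_def min_label_le)
    moreover have "Min L \<le> min_label t" using min_label_in[OF nonempty[OF wf]] sub assms by auto
    ultimately show False by simp
  qed
  moreover have "t \<in> trees ?S" using us by (auto simp: forests_def trees_def)
  moreover have "ts \<in> forests m (L - ?S)" using us by (auto simp: forests_def)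
  ultimately show "us \<in> ?R" using sub by (intro UN_I[of ?S]) auto
next
  fix us assume "us \<in> ?R"
  then obtain S where S: "S \<subseteq> L" "Min L \<in> S"
    and "us \<in> (\<lambda>(t, ts). t # ts) ` (trees S \<times> forests m (L - S))"
    by (elim UN_E CollectE conjE)
  then obtain t ts where [simp]: "us = t # ts"
    and t: "t \<in> trees S" and ts: "ts \<in> forests m (L - S)"
    by (elim imageE) auto
  have "min_label t < min_label u" if "u \<in> set ts" for u
  proof -
    have u: "leaves u \<noteq> []" "set (leaves u) \<subseteq> L - S" using ts that nonempty by (auto simp: forests_def)
    have "min_label t = Min L"
      unfolding min_label_Min[OF t]
    proof (rule antisym)
      show "Min S \<le> Min L" using S assms finite_subset by (metis Min_le)
      show "Min L \<le> Min S" using S assms by (intro Min_antimono) auto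
    qed
    moreover have "Min L \<le> min_label u" "min_label u \<noteq> Min L"
      using u min_label_in[OF u(1)] S assms by (auto simp: subset_iff)
    ultimately show ?thesis by simp
  qed
  then show "us \<in> forests (Suc m) L"
    using t ts S by (auto simp: forests_def trees_def)
qed

lemma finite_forests: "finite L \<Longrightarrow> finite (forests m L)"
proof (induction m arbitrary: L)
  case 0
  then show ?case by (simp add: forests_0)
next
  case (Suc m)
  show ?case
  proof (cases "L = {}")
    case True
    have "forests (Suc m) L = {}"
      using True nonempty by (auto simp: forests_def length_Suc_conv)
    then show ?thesis by simp
  next
    case False
    have "finite {S. S \<subseteq> L \<and> Min L \<in> S}" using Suc.prems by simp
    then show ?thesis unfolding forests_Suc[OF Suc.prems False]
    proof (rule finite_UN_I)
      fix S assume "S \<in> {S. S \<subseteq> L \<and> Min L \<in> S}"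
      then have "finite S" using Suc.prems finite_subset by blast
      then show "finite ((\<lambda>(t, ts). t # ts) ` (trees S \<times> forests m (L - S)))"
        by (intro finite_imageI finite_cartesian_product finite_trees Suc.IH finite_Diff Suc.prems)
    qed
  qed
qed

text \<open>The count for \<open>m\<close> trees enters as an abstract function \<open>c\<close> of
  the number of labels, so that the recursion can drive the induction showing that forest counts
  depend only on this number.\<close>

lemma card_forests_Suc:
  assumes "finite L" "L \<noteq> {}"
    and IH: "\<And>K. finite K \<Longrightarrow> card (forests m K) = c (card K)"
  shows "card (forests (Suc m) L) =
    (\<Sum>j\<le>card L - 1. (card L - 1 choose j) * (tree_count (Suc j) * c (card L - 1 - j)))"
proof -
  let ?K = "L - {Min L}" and ?F = "\<lambda>S. (\<lambda>(t, ts). t # ts) ` (trees S \<times> forests m (L - S))"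
  have Min: "Min L \<in> L" using assms by simp
  have fin: "finite S" if "S \<subseteq> L" for S using that assms finite_subset by blast
  \<comment> \<open>The first tree takes \<open>Min L\<close> and some \<open>j\<close> labels from
    \<open>?K\<close>, whence the index \<open>Suc j\<close> of \<open>tree_count\<close>.\<close>
  have I: "{S. S \<subseteq> L \<and> Min L \<in> S} = insert (Min L) ` Pow ?K"
  proof (intro equalityI subsetI)
    fix S assume "S \<in> {S. S \<subseteq> L \<and> Min L \<in> S}"
    then have "S = insert (Min L) (S - {Min L})" "S - {Min L} \<in> Pow ?K" by auto
    then show "S \<in> insert (Min L) ` Pow ?K" by blast
  qed (use Min in auto)
  have inj: "inj_on (insert (Min L)) (Pow ?K)" by (rule inj_onI) blast
  have card_F: "card (?F S) = card (trees S) * card (forests m (L - S))" for S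
    by (subst card_image) (auto simp: inj_on_def card_cartesian_product)
  have "card (forests (Suc m) L) = (\<Sum>S\<in>{S. S \<subseteq> L \<and> Min L \<in> S}. card (?F S))"
    unfolding forests_Suc[OF assms(1,2)]
  proof (rule card_UN_disjoint)
    show "\<forall>S\<in>{S. S \<subseteq> L \<and> Min L \<in> S}. finite (?F S)"
      using fin assms(1)
      by (intro ballI finite_imageI finite_cartesian_product finite_trees finite_forests) simp_all
    show "\<forall>S\<in>{S. S \<subseteq> L \<and> Min L \<in> S}. \<forall>T\<in>{S. S \<subseteq> L \<and> Min L \<in> S}. S \<noteq> T \<longrightarrow> ?F S \<inter> ?F T = {}"
      by (auto simp: trees_def)
  qed (use assms in simp)
  also have "\<dots> = (\<Sum>S\<in>Pow ?K. card (?F (insert (Min L) S)))"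
    unfolding I by (simp add: sum.reindex[OF inj])
  also have "\<dots> = (\<Sum>S\<in>Pow ?K. tree_count (Suc (card S)) * c (card ?K - card S))"
  proof (rule sum.cong[OF refl])
    fix S assume S: "S \<in> Pow ?K"
    then have fS: "finite S" "Min L \<notin> S" using fin[of S] by auto
    have "L - insert (Min L) S = ?K - S" by auto
    then have "card (L - insert (Min L) S) = card ?K - card S"
      using S fS by (simp add: card_Diff_subset)
    then show "card (?F (insert (Min L) S)) = tree_count (Suc (card S)) * c (card ?K - card S)"
      using fS assms(1) by (simp only: card_F card_trees IH finite_insert finite_Diff card_insert_disjoint simp_thms)
  qed
  also have "\<dots> = (\<Sum>j\<le>card ?K. (card ?K choose j) * (tree_count (Suc j) * c (card ?K - j)))"
    using assms(1) by (intro sum_subsets_card) simp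
  finally show ?thesis using Min assms(1) by simp
qed

lemma card_forests: "finite L \<Longrightarrow> card (forests m L) = forest_count m (card L)"
proof (induction m arbitrary: L)
  case 0
  then show ?case
    by (cases "L = {}") (auto simp: forests_0 forest_count_def Suc_le_eq card_gt_0_iff)
next
  case (Suc m)
  show ?case
  proof (cases "L = {}")
    case False
    with Suc.prems have "0 < card L" by (simp add: card_gt_0_iff)
    then have ne: "{1..card L} \<noteq> {}" by (simp add: Suc_le_eq)
    show ?thesis
      using card_forests_Suc[OF Suc.prems False Suc.IH] card_forests_Suc[OF _ ne Suc.IH]
      by (simp add: forest_count_def)
  qed (simp add: forest_count_def)
qed

lemma forest_count_Suc_Suc:
  "forest_count (Suc m) (Suc n) = (\<Sum>j\<le>n. (n choose j) * (tree_count (Suc j) * forest_count m (n - j)))"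
  using card_forests_Suc[of "{1..Suc n}" m, OF _ _ card_forests] by (simp add: forest_count_def)

lemma forest_count_Suc_0: "forest_count (Suc m) 0 = 0"
  using nonempty by (auto simp: forest_count_def forests_def length_Suc_conv card_eq_0_iff)

section \<open>Exponential generating functions of trees and forests\<close>

definition tree_egf :: "real fps" where
  "tree_egf = Abs_fps (\<lambda>n. tree_count n / fact n)"

lemma tree_count_0: "tree_count 0 = 0"
  using trees_nonempty[of _ "{}"] by (auto simp: tree_count_def card_eq_0_iff)

text \<open>The tree of a sorted forest that contains the least label comes first; removing it yields
  the derivative of the forest series.\<close>

lemma forest_egf: "Abs_fps (\<lambda>n. real (forest_count m n) / fact n) = fps_const (1 / fact m) * tree_egf ^ m"
proof (induction m)
  case 0
  have "forest_count 0 n = (if n = 0 then 1 else 0)" for n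
    by (auto simp: forest_count_def forests_0)
  then show ?case by (auto simp: fps_eq_iff)
next
  case (Suc m)
  let ?G = "\<lambda>m. Abs_fps (\<lambda>n. real (forest_count m n) / fact n)"
  have "fps_deriv (?G (Suc m)) = fps_deriv tree_egf * ?G m"
  proof (rule fps_ext)
    fix n
    have "fps_nth (fps_deriv (?G (Suc m))) n = forest_count (Suc m) (Suc n) / fact n"
      by (simp del: of_nat_Suc)
    also have "\<dots> = (\<Sum>j\<le>n. (tree_count (Suc j) / fact j) * (forest_count m (n - j) / fact (n - j)))"
      unfolding forest_count_Suc_Suc of_nat_sum sum_divide_distrib
      by (rule sum.cong) (auto simp: binomial_fact field_simps)
    also have "\<dots> = fps_nth (fps_deriv tree_egf * ?G m) n"
      unfolding fps_mult_nth atLeast0AtMost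
      by (rule sum.cong[OF refl]) (simp add: tree_egf_def del: of_nat_Suc)
    finally show "fps_nth (fps_deriv (?G (Suc m))) n = fps_nth (fps_deriv tree_egf * ?G m) n" .
  qed
  also have "\<dots> = fps_const (1 / fact m) * (fps_deriv tree_egf * tree_egf ^ m)"
    unfolding Suc by (simp only: mult_ac)
  \<comment> \<open>The factor \<open>Suc m\<close> is the one that differentiating
    \<open>tree_egf ^ Suc m\<close> produces.\<close>
  also have "(1 / fact m :: real) = 1 / fact (Suc m) * real (Suc m)"
    by (simp del: of_nat_Suc)
  also have "fps_const \<dots> * (fps_deriv tree_egf * tree_egf ^ m)
      = fps_deriv (fps_const (1 / fact (Suc m)) * tree_egf ^ Suc m)"
    by (simp only: fps_const_mult[symmetric] fps_deriv_mult_const_left fps_deriv_power diff_Suc_1 mult_ac)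
  \<comment> \<open>Equal derivatives leave only the constant terms to compare; both vanish, as
    every tree has a leaf.\<close>
  finally show ?case
    unfolding fps_deriv_eq_iff
    by (simp add: forest_count_Suc_0 tree_egf_def tree_count_0)
qed

lemma forest_count_eq: "real (forest_count m n) / fact n = fps_nth (tree_egf ^ m) n / fact m"
  using arg_cong[OF forest_egf, of "\<lambda>F. fps_nth F n" m] by simp

end

section \<open>Decomposition at the root\<close>

lemma graft_full_subtree: "i \<in> set (leaves s) \<Longrightarrow> \<phi> i \<in> full_subtrees (graft \<phi> s)"
  by (induction s) (auto simp: full_subtrees_refl)

lemma distinct_concat_map_imp:
  "distinct (concat (map f xs)) \<Longrightarrow> (\<And>x. x \<in> set xs \<Longrightarrow> f x \<noteq> []) \<Longrightarrow> distinct xs"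
proof (induction xs)
  case (Cons x xs)
  from Cons.prems(2)[of x] obtain i where "i \<in> set (f x)" by (cases "f x") auto
  with Cons show ?case by auto
qed simp

text \<open>The right-hand side depends on \<open>xs\<close> only through its set, so distinctness
  passes from the leaf order of a tree to the sorted order of its labels.\<close>

lemma distinct_concat_map_iff:
  "distinct xs \<Longrightarrow> distinct (concat (map f xs)) \<longleftrightarrow> (\<forall>x\<in>set xs. distinct (f x)) \<and>
     pairwise (\<lambda>x y. disjnt (set (f x)) (set (f y))) (set xs)"
proof (induction xs)
  case (Cons x xs)
  then have "x \<noteq> y" if "y \<in> set xs" for y using that by auto
  then have "set (f x) \<inter> set (concat (map f xs)) = {} \<longleftrightarrow>
      (\<forall>y. y \<in> set xs \<and> y \<noteq> x \<longrightarrow> disjnt (set (f x)) (set (f y)) \<and> disjnt (set (f y)) (set (f x)))"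
    by (auto simp: disjnt_def)
  with Cons show ?case
    by (simp add: pairwise_insert del: set_concat) blast
qed simp

text \<open>Inverts the relabelling done by \<open>st\<close>; ranks start at 1, list positions at
  0.\<close>

lemma sorted_list_of_set_nth_rank:
  assumes "finite A" "i \<in> A"
  shows "sorted_list_of_set A ! (card {j \<in> A. j \<le> i} - 1) = (i :: nat)"
proof -
  let ?xs = "sorted_list_of_set A"
  have sm: "sorted_wrt (<) ?xs" by simp
  obtain k where k: "k < length ?xs" "?xs ! k = i"
    using assms by (metis in_set_conv_nth set_sorted_list_of_set)
  have "{j \<in> A. j \<le> i} = (!) ?xs ` {..k}"
  proof (intro equalityI subsetI)
    fix j assume j: "j \<in> {j \<in> A. j \<le> i}"
    then obtain m where m: "m < length ?xs" "?xs ! m = j"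
      using assms(1) by (metis (no_types, lifting) in_set_conv_nth mem_Collect_eq set_sorted_list_of_set)
    have "m \<le> k"
    proof (rule ccontr)
      assume "\<not> m \<le> k"
      with m k have "?xs ! k < ?xs ! m" by (intro sorted_wrt_nth_less[OF sm]) auto
      with j m k show False by simp
    qed
    with m show "j \<in> (!) ?xs ` {..k}" by auto
  next
    fix j assume "j \<in> (!) ?xs ` {..k}"
    then obtain m where m: "m \<le> k" "j = ?xs ! m" by auto
    then have "?xs ! m \<in> set ?xs" using k by (intro nth_mem) simp
    moreover have "?xs ! m \<le> ?xs ! k" using m k by (intro sorted_nth_mono) auto
    ultimately show "j \<in> {j \<in> A. j \<le> i}" using m k assms by simp
  qed
  moreover have "inj_on ((!) ?xs) {..k}"
    using k by (intro inj_on_nth) auto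
  ultimately have "card {j \<in> A. j \<le> i} = Suc k" by (simp add: card_image)
  with k show ?thesis by simp
qed

context tree_patterns
begin

text \<open>The branches in \<open>ts\<close> avoid \<open>P\<close>, so the occurrence sits at the
  root, and undoing its truncation writes the whole tree as \<open>p\<close> with avoiding trees
  grafted on. Leaf \<open>r\<close> receives entry \<open>r - 1\<close>, as labels start at
  1.\<close>

lemma occurrence_at_root:
  assumes ts: "ts \<in> forests d L" and x: "x \<in> X" and p: "p \<in> P" "\<not> avoids (Node x ts) p"
  obtains us where "us \<in> forests (length (leaves p)) L"
    "Node x ts = graft (\<lambda>r. us ! (r - 1)) p" "\<exists>y ps. p = Node y ps"
proof -
  let ?T = "Node x ts"
  have wf: "well_formed d X ?T" and dist: "distinct (leaves ?T)" and set_T: "set (leaves ?T) = L"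
    using ts x by (auto simp: forests_def)
  have av: "well_formed d X t" "\<forall>p\<in>P. avoids t p" if "t \<in> set ts" for t
    using ts that by (auto simp: forests_def)
  obtain S where S: "subtree S ?T" "p = st S" using p by (auto simp: avoids_def)
  then obtain y ss U where Sy: "S = Node y ss" and U: "U \<in> full_subtrees ?T" "truncation S U"
    by (auto simp: subtree_def)
  have "U = ?T"
  proof (rule ccontr)
    assume "U \<noteq> ?T"
    with U obtain t where t: "t \<in> set ts" "U \<in> full_subtrees t" by auto
    with Sy U(2) have "subtree S t" by (auto simp: subtree_def)
    with av(2)[OF t(1)] p(1) S(2) show False by (auto simp: avoids_def)
  qed
  with truncation_graft[OF U(2) _ d1] wf dist obtain \<phi>
    where T: "?T = graft \<phi> S" and ml: "\<And>i. i \<in> set (leaves S) \<Longrightarrow> min_label (\<phi> i) = i" by blast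
  \<comment> \<open>The root of \<open>S\<close> is internal, so each leaf of \<open>S\<close> lies
    below a child of the root; hence \<open>\<phi> i\<close> is a full subtree of a branch in
    \<open>ts\<close> and inherits its properties.\<close>
  have \<phi>: "well_formed d X (\<phi> i)" "\<forall>p\<in>P. avoids (\<phi> i) p" if i: "i \<in> set (leaves S)" for i
  proof -
    obtain s where s: "s \<in> set ss" "i \<in> set (leaves s)" using i Sy by auto
    have t: "graft \<phi> s \<in> set ts" using T Sy s by simp
    have sub: "\<phi> i \<in> full_subtrees (graft \<phi> s)" using s(2) by (rule graft_full_subtree)
    show "well_formed d X (\<phi> i)" using well_formed_full_subtree[OF sub av(1)[OF t]] .
    show "\<forall>p\<in>P. avoids (\<phi> i) p" using av(2)[OF t] avoids_full_subtree[OF _ sub] by blast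
  qed
  have dist_graft: "distinct (concat (map (\<lambda>i. leaves (\<phi> i)) (leaves S)))"
    using dist unfolding T leaves_graft .
  have dist_S: "distinct (leaves S)"
    using distinct_concat_map_imp[OF dist_graft] \<phi>(1) nonempty by blast
  \<comment> \<open>Listed by increasing \<open>i\<close>, the trees \<open>\<phi> i\<close> have
    exactly \<open>ms\<close> as their list of least labels, so the forest is sorted.\<close>
  define ms where "ms = sorted_list_of_set (set (leaves S))"
  have ms: "set ms = set (leaves S)" "distinct ms" by (simp_all add: ms_def)
  have len: "length ms = length (leaves p)"
    using dist_S by (simp add: ms_def S(2) st_def distinct_card)
  have "map min_label (map \<phi> ms) = ms"
    using ml ms by (auto intro: map_idI)
  then have "sorted_wrt (<) (map min_label (map \<phi> ms))" by (simp only: ms_def strict_sorted_list_of_set)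
  moreover have "distinct (concat (map leaves (map \<phi> ms)))"
    using dist_graft unfolding distinct_concat_map_iff[OF dist_S]
    by (simp add: comp_def distinct_concat_map_iff[OF ms(2)] ms(1))
  moreover have "set (concat (map leaves (map \<phi> ms))) = L"
    using set_T unfolding T leaves_graft by (simp add: ms(1))
  ultimately have "map \<phi> ms \<in> forests (length (leaves p)) L"
    using \<phi> ms(1) len by (simp add: forests_def)
  moreover have "?T = graft (\<lambda>r. map \<phi> ms ! (r - 1)) p"
    unfolding T S(2) st_def graft_relabel
  proof (rule graft_cong)
    fix i assume i: "i \<in> set (leaves S)"
    let ?r = "card {j \<in> set (leaves S). j \<le> i}"
    have "?r > 0" using i by (auto simp: card_gt_0_iff)
    moreover have "?r \<le> length ms"
      unfolding ms_def by (auto intro: card_mono)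
    moreover have "ms ! (?r - 1) = i"
      unfolding ms_def using i by (intro sorted_list_of_set_nth_rank) auto
    ultimately show "\<phi> i = ((\<lambda>r. map \<phi> ms ! (r - 1)) \<circ> (\<lambda>i. card {j \<in> set (leaves S). j \<le> i})) i"
      by simp
  qed
  moreover have "\<exists>y ps. p = Node y ps" by (simp add: S(2) Sy st_def)
  ultimately show thesis using that by blast
qed

section \<open>Upper and lower estimates for attaching a root\<close>

lemma card_Node_image:
  "card ((\<lambda>(x, ts). Node x ts) ` (X \<times> forests d {1..n})) = card X * forest_count d n"
  by (subst card_image) (auto simp: inj_on_def card_cartesian_product forest_count_def)

lemma finite_LT_n: "finite (LT_n d X l)"
  by (rule finite_subset[OF _ finite_bounded_trees[of "{1..l}" l]]) (auto simp: LT_n_def LT_def)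

lemma two_le_leaf_count: "well_formed d X (Node x ts) \<Longrightarrow> 2 \<le> length (leaves (Node x ts))"
  using length_le_leaf_count[of ts] nonempty d by fastforce

text \<open>Branches of avoiding trees avoid, and a single leaf occurs only for
  \<open>n = 1\<close>. Without patterns this bounds the series of all trees from above.\<close>

lemma tree_count_le: "tree_count n \<le> card X * forest_count d n + (if n = 1 then 1 else 0)"
proof -
  let ?N = "(\<lambda>(x, ts). Node x ts) ` (X \<times> forests d {1..n})" and ?L = "if n = 1 then {Leaf 1 :: 'x ltree} else {}"
  have "trees {1..n} \<subseteq> ?N \<union> ?L"
  proof
    fix t assume t: "t \<in> trees {1..n}"
    show "t \<in> ?N \<union> ?L"
    proof (cases t)
      case (Leaf i)
      with t have *: "{1..n} = {i}" by (simp add: trees_def)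
      then have "n = 1" using card_atLeastAtMost[of 1 n] by simp
      with * Leaf show ?thesis by simp
    next
      case (Node x ts)
      have "avoids u p" if "u \<in> set ts" "p \<in> P" for u p
        using t that Node by (auto simp: trees_def intro!: avoids_full_subtree[of t p u] full_subtrees_refl)
      then have "(x, ts) \<in> X \<times> forests d {1..n}"
        using t Node by (auto simp: trees_def forests_def)
      then show ?thesis unfolding Node by blast
    qed
  qed
  moreover have "finite ?N"
    using finite_X finite_forests by (intro finite_imageI finite_cartesian_product) auto
  ultimately have "tree_count n \<le> card (?N \<union> ?L)"
    unfolding tree_count_def by (intro card_mono) auto
  also have "\<dots> \<le> card ?N + card ?L" by (rule card_Un_le)
  also have "card ?L = (if n = 1 then 1 else 0)" by simp
  finally show ?thesis by (simp only: card_Node_image)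
qed

text \<open>A root over avoiding branches either avoids \<open>P\<close> or lies in some
  \<open>?G l\<close>, the graftings of forests onto patterns with \<open>l\<close> leaves.
  Different graftings may give the same tree, so \<open>?G l\<close> is only bounded from
  above.\<close>

lemma golod_shafarevich_count:
  assumes P: "P \<subseteq> LT d X"
  shows "card X * forest_count d n + (if n = 1 then 1 else 0)
    \<le> tree_count n + (\<Sum>l=2..n. card (P \<inter> LT_n d X l) * forest_count l n)"
proof -
  let ?N = "(\<lambda>(x, ts). Node x ts) ` (X \<times> forests d {1..n})" and ?L = "if n = 1 then {Leaf 1 :: 'x ltree} else {}"
  let ?G = "\<lambda>l. (\<lambda>(p, us). graft (\<lambda>r. us ! (r - 1)) p) ` ((P \<inter> LT_n d X l) \<times> forests l {1..n})"
  have finP: "finite (P \<inter> LT_n d X l)" for l using finite_LT_n by blast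
  have finG: "finite (?G l)" for l
    using finP finite_forests by (intro finite_imageI finite_cartesian_product) auto
  have card_G: "card (?G l) \<le> card (P \<inter> LT_n d X l) * forest_count l n" for l
    using card_image_le[of "(P \<inter> LT_n d X l) \<times> forests l {1..n}"] finP finite_forests[of "{1..n}"]
    by (simp add: forest_count_def card_cartesian_product)
  have finN: "finite ?N"
    using finite_X finite_forests by (intro finite_imageI finite_cartesian_product) auto
  have "?N \<union> ?L \<subseteq> trees {1..n} \<union> (\<Union>l\<in>{2..n}. ?G l)"
  proof
    fix t assume "t \<in> ?N \<union> ?L"
    then consider "t \<in> ?N" | "n = 1" "t = Leaf 1" by (auto split: if_splits)
    then show "t \<in> trees {1..n} \<union> (\<Union>l\<in>{2..n}. ?G l)"
    proof cases
      case 1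
      then obtain x ts where t: "t = Node x ts" and x: "x \<in> X" and ts: "ts \<in> forests d {1..n}" by auto
      show ?thesis
      proof (cases "\<forall>p\<in>P. avoids t p")
        case True
        then have "t \<in> trees {1..n}" using t x ts by (auto simp: trees_def forests_def)
        then show ?thesis by simp
      next
        case False
        then obtain p where p: "p \<in> P" "\<not> avoids (Node x ts) p" using t by auto
        obtain us where us: "us \<in> forests (length (leaves p)) {1..n}"
          and graft: "Node x ts = graft (\<lambda>r. us ! (r - 1)) p" and "\<exists>y ps. p = Node y ps"
          using occurrence_at_root[OF ts x p] by blast
        define l where "l = length (leaves p)"
        have pl: "p \<in> P \<inter> LT_n d X l" using p P by (auto simp: LT_n_def l_def)
        \<comment> \<open>An occurring pattern has an internal root, so the one-vertex tree
          contributes nothing.\<close>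
        have "2 \<le> l"
          using \<open>\<exists>y ps. p = Node y ps\<close> P p(1) two_le_leaf_count by (auto simp: l_def LT_def simp del: leaves.simps)
        \<comment> \<open>Each of the \<open>l\<close> grafted trees uses at least one of the
          \<open>n\<close> labels.\<close>
        moreover have "l \<le> n"
        proof -
          have us': "length us = l" "distinct (concat (map leaves us))" "set (concat (map leaves us)) = {1..n}"
            "\<forall>t\<in>set us. well_formed d X t"
            using us by (auto simp: forests_def l_def)
          have "length us \<le> length (concat (map leaves us))"
            using us'(4) nonempty by (intro length_le_leaf_count) auto
          also have "\<dots> = n" using distinct_card[OF us'(2)] us'(3) by simp
          finally show ?thesis using us'(1) by simp
        qed
        moreover have "t \<in> ?G l"
          using pl us graft t by (intro image_eqI[of _ _ "(p, us)"]) (auto simp: l_def)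
        ultimately show ?thesis by (intro UnI2 UN_I[of l]) auto
      qed
    next
      case 2
      then show ?thesis by (auto simp: trees_def avoids_Leaf)
    qed
  qed
  moreover have "finite (trees {1..n} \<union> (\<Union>l\<in>{2..n}. ?G l))"
    using finG finite_trees by (intro finite_UnI finite_UN_I) auto
  ultimately have "card (?N \<union> ?L) \<le> card (trees {1..n} \<union> (\<Union>l\<in>{2..n}. ?G l))"
    by (rule card_mono[rotated])
  also have "\<dots> \<le> card (trees {1..n}) + card (\<Union>l\<in>{2..n}. ?G l)" by (rule card_Un_le)
  also have "card (\<Union>l\<in>{2..n}. ?G l) \<le> (\<Sum>l=2..n. card (?G l))" by (rule card_UN_le) simp
  also have "\<dots> \<le> (\<Sum>l=2..n. card (P \<inter> LT_n d X l) * forest_count l n)"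
    by (intro sum_mono card_G)
  finally have "card (?N \<union> ?L) \<le> tree_count n + (\<Sum>l=2..n. card (P \<inter> LT_n d X l) * forest_count l n)"
    by (simp add: tree_count_def)
  moreover have "card (?N \<union> ?L) = card ?N + card ?L"
    using finN by (intro card_Un_disjoint) auto
  moreover have "card ?L = (if n = 1 then 1 else 0)" by simp
  ultimately show ?thesis by (simp only: card_Node_image)
qed

lemma tree_egf_le:
  "fps_nth tree_egf n \<le> fps_nth fps_X n + card X / fact d * fps_nth (tree_egf ^ d) n"
proof -
  have "real (tree_count n) \<le> card X * real (forest_count d n) + (if n = 1 then 1 else 0)"
    using tree_count_le[of n] by (simp flip: of_nat_mult add: of_nat_le_iff split: if_splits)
  then have "real (tree_count n) / fact n
      \<le> (card X * real (forest_count d n) + (if n = 1 then 1 else 0)) / fact n"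
    by (intro divide_right_mono) auto
  also have "\<dots> = card X * (real (forest_count d n) / fact n) + (if n = 1 then 1 else 0)"
    by (simp add: add_divide_distrib)
  finally show ?thesis by (simp add: forest_count_eq tree_egf_def fps_X_def)
qed

lemma golod_shafarevich_egf:
  assumes "P \<subseteq> LT d X"
  shows "fps_nth fps_X n + card X / fact d * fps_nth (tree_egf ^ d) n
    \<le> fps_nth tree_egf n + (\<Sum>l=2..n. card (P \<inter> LT_n d X l) / fact l * fps_nth (tree_egf ^ l) n)"
proof -
  have "real (card X * forest_count d n + (if n = 1 then 1 else 0))
    \<le> real (tree_count n + (\<Sum>l=2..n. card (P \<inter> LT_n d X l) * forest_count l n))"
    using golod_shafarevich_count[OF assms] by (rule of_nat_mono)
  then have "real (card X * forest_count d n + (if n = 1 then 1 else 0)) / fact n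
    \<le> real (tree_count n + (\<Sum>l=2..n. card (P \<inter> LT_n d X l) * forest_count l n)) / fact n"
    by (rule divide_right_mono) simp
  moreover have "real (card X * forest_count d n + (if n = 1 then 1 else 0)) / fact n
      = card X * (real (forest_count d n) / fact n) + (if n = 1 then 1 else 0)"
    by (simp add: add_divide_distrib)
  moreover have "real (tree_count n + (\<Sum>l=2..n. card (P \<inter> LT_n d X l) * forest_count l n)) / fact n
      = tree_count n / fact n + (\<Sum>l=2..n. card (P \<inter> LT_n d X l) * (real (forest_count l n) / fact n))"
    by (simp add: add_divide_distrib sum_divide_distrib)
  ultimately show ?thesis by (simp add: forest_count_eq tree_egf_def fps_X_def)
qed

end

section \<open>Coefficientwise inequalities of power series\<close>

lemma fps_power_nonneg:
  fixes A :: "real fps"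
  shows "(\<And>n. fps_nth A n \<ge> 0) \<Longrightarrow> fps_nth (A ^ m) n \<ge> 0"
proof (induction m arbitrary: n)
  case (Suc m)
  then show ?case by (auto simp: fps_mult_nth intro!: sum_nonneg)
qed simp

text \<open>With zero constant terms, coefficient \<open>j\<close> of the \<open>m\<close>-th power
  involves only coefficients up to \<open>j - (m - 1)\<close>, and the bound on \<open>j\<close>
  keeps these below \<open>n\<close>.\<close>

lemma fps_power_nth_mono:
  fixes A B :: "real fps"
  assumes "\<And>i. i < n \<Longrightarrow> 0 \<le> fps_nth B i" "\<And>i. i < n \<Longrightarrow> fps_nth B i \<le> fps_nth A i"
    and A0: "fps_nth A 0 = 0" "fps_nth B 0 = 0" and "m \<ge> 1" "j + 1 < n + m"
  shows "0 \<le> fps_nth (B ^ m) j \<and> fps_nth (B ^ m) j \<le> fps_nth (A ^ m) j"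
  using assms(5,6)
proof (induction m arbitrary: j rule: dec_induct)
  case base
  then show ?case using assms by simp
next
  case (step m)
  have "0 \<le> fps_nth B i * fps_nth (B ^ m) (j - i) \<and>
      fps_nth B i * fps_nth (B ^ m) (j - i) \<le> fps_nth A i * fps_nth (A ^ m) (j - i)"
    if i: "i \<le> j" for i
  proof (cases "i = 0 \<or> i \<ge> n")
    case True
    \<comment> \<open>Here \<open>j - i < m\<close>, and both \<open>m\<close>-th powers vanish
      below \<open>m\<close>.\<close>
    have "fps_nth (A ^ m) (j - i) = 0" "fps_nth (B ^ m) (j - i) = 0" if "i \<ge> n"
      using that i step.prems A0 by (auto intro!: startsby_zero_power_prefix[rule_format])
    with True A0 show ?thesis by auto
  next
    case False
    then have "j - i + 1 < n + m" using i step.prems by linarith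
    from step.IH[OF this] assms(1,2)[of i] False show ?thesis
      by (auto intro!: mult_mono)
  qed
  then show ?case by (auto simp: fps_mult_nth intro!: sum_nonneg sum_mono)
qed

text \<open>\<open>A\<close> is a supersolution and \<open>B\<close> a subsolution of
  \<open>Y = z + c Y^d\<close>. As \<open>d \<ge> 2\<close>, coefficient \<open>n\<close> of a
  \<open>d\<close>-th power depends only on coefficients below \<open>n\<close>, so strong induction
  applies.\<close>

lemma fps_fixpoint_mono:
  fixes A B :: "real fps"
  assumes "d \<ge> 2" "c \<ge> 0" "fps_nth A 0 = 0" "fps_nth B 0 = 0" "\<And>n. fps_nth B n \<ge> 0"
    and A: "\<And>n. fps_nth fps_X n + c * fps_nth (A ^ d) n \<le> fps_nth A n"
    and B: "\<And>n. fps_nth B n \<le> fps_nth fps_X n + c * fps_nth (B ^ d) n"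
  shows "fps_nth B n \<le> fps_nth A n"
proof (induction n rule: less_induct)
  case (less n)
  have "fps_nth (B ^ d) n \<le> fps_nth (A ^ d) n"
    using fps_power_nth_mono[of n B A d n] less assms by auto
  then have "c * fps_nth (B ^ d) n \<le> c * fps_nth (A ^ d) n"
    using assms(2) by (rule mult_left_mono)
  with A[of n] B[of n] show ?case by linarith
qed

text \<open>By induction the earlier coefficients of \<open>E\<close> dominate those of
  \<open>F\<close> and so are nonnegative. Their products with coefficients of \<open>Q\<close> at
  positive indices are nonpositive, so coefficient \<open>n\<close> of \<open>E * Q\<close> is at
  most that of \<open>E\<close>.\<close>

lemma fps_mult_le_one_cancel:
  fixes E Q :: "real fps"
  assumes "fps_nth Q 0 = 1" "\<And>n. n \<ge> 1 \<Longrightarrow> fps_nth Q n \<le> 0"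
    and F: "\<And>n. fps_nth F n \<ge> 0" "\<And>n. fps_nth F n \<le> fps_nth (E * Q) n"
  shows "fps_nth F n \<le> fps_nth E n"
proof (induction n rule: less_induct)
  case (less n)
  have "fps_nth (E * Q) n = (\<Sum>i<n. fps_nth E i * fps_nth Q (n - i)) + fps_nth E n"
    using assms(1) by (simp add: fps_mult_nth atLeast0AtMost flip: lessThan_Suc_atMost)
  moreover have "(\<Sum>i<n. fps_nth E i * fps_nth Q (n - i)) \<le> 0"
  proof (intro sum_nonpos mult_nonneg_nonpos)
    fix i assume "i \<in> {..<n}"
    then show "fps_nth E i \<ge> 0" "fps_nth Q (n - i) \<le> 0"
      using less[of i] F(1)[of i] assms(2)[of "n - i"] by auto
  qed
  ultimately show ?case using F(2)[of n] by linarith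
qed

text \<open>\<open>H\<close> is a series in \<open>z^e\<close>, so dividing it by
  \<open>1 - (z/\<alpha>)^e\<close> yields, at multiples of \<open>e\<close>, the partial sums of
  \<open>H\<close> at \<open>\<alpha>\<close> up to a positive scaling. Their signs are given by
  \<open>partial\<close>.\<close>

lemma fps_divide_by_root:
  fixes H :: "real fps"
  assumes "e \<ge> 1" "\<alpha> > 0" "fps_nth H 0 = 1" "\<And>j. \<not> e dvd j \<Longrightarrow> fps_nth H j = 0"
    and partial: "\<And>j. j \<ge> e \<Longrightarrow> (\<Sum>i\<le>j. fps_nth H i * \<alpha> ^ i) \<le> 0"
  obtains Q where "H = (1 - fps_const (1 / \<alpha> ^ e) * fps_X ^ e) * Q" "fps_nth Q 0 = 1"
    "\<And>n. n \<ge> 1 \<Longrightarrow> fps_nth Q n \<le> 0"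
proof
  define s where "s j = (\<Sum>i\<le>j. fps_nth H i * \<alpha> ^ i)" for j
  let ?Q = "Abs_fps (\<lambda>j. if e dvd j then s j / \<alpha> ^ j else 0)"
  show "fps_nth ?Q 0 = 1" using assms(3) by (simp add: s_def)
  show "fps_nth ?Q n \<le> 0" if "n \<ge> 1" for n
  proof (cases "e dvd n")
    case True
    with that have "n \<ge> e" by (auto intro: dvd_imp_le)
    from partial[OF this] True assms(2) show ?thesis
      by (simp add: s_def divide_nonpos_pos)
  qed simp
  show "H = (1 - fps_const (1 / \<alpha> ^ e) * fps_X ^ e) * ?Q"
  proof (rule fps_ext)
    fix n
    have coeff: "fps_nth ((1 - fps_const (1 / \<alpha> ^ e) * fps_X ^ e) * ?Q) n
        = fps_nth ?Q n - (if n < e then 0 else fps_nth ?Q (n - e) / \<alpha> ^ e)"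
      by (simp add: left_diff_distrib mult.assoc fps_X_power_mult_nth)
    consider "\<not> e dvd n" | "n = 0" | "e dvd n" "n \<ge> e"
      using dvd_imp_le by (cases "n = 0") auto
    then show "fps_nth H n = fps_nth ((1 - fps_const (1 / \<alpha> ^ e) * fps_X ^ e) * ?Q) n"
    proof cases
      case 1
      then show ?thesis unfolding coeff using assms(4) by (auto simp: dvd_minus_self)
    next
      case 2
      then show ?thesis unfolding coeff using assms by (simp add: s_def)
    next
      case 3
      \<comment> \<open>No multiple of \<open>e\<close> lies strictly between \<open>n - e\<close>
        and \<open>n\<close>, so only the term at \<open>n\<close> is added.\<close>
      have "s n = s (n - e) + fps_nth H n * \<alpha> ^ n"
      proof -
        have "{..n} = {..n - e} \<union> ({n - e<..<n} \<union> {n})" using 3 assms(1) by auto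
        then have "s n = s (n - e) + (\<Sum>i\<in>{n - e<..<n} \<union> {n}. fps_nth H i * \<alpha> ^ i)"
          unfolding s_def using 3 assms(1) by (subst sum.union_disjoint[symmetric]) auto
        also have "(\<Sum>i\<in>{n - e<..<n} \<union> {n}. fps_nth H i * \<alpha> ^ i)
            = (\<Sum>i\<in>{n - e<..<n}. fps_nth H i * \<alpha> ^ i) + fps_nth H n * \<alpha> ^ n"
          by (subst sum.union_disjoint) auto
        also have "(\<Sum>i\<in>{n - e<..<n}. fps_nth H i * \<alpha> ^ i) = 0"
        proof (rule sum.neutral, rule ballI)
          fix i assume i: "i \<in> {n - e<..<n}"
          have "\<not> e dvd i"
          proof
            assume "e dvd i"
            with 3(1) have "e dvd n - i" by simp
            moreover have "0 < n - i" "n - i < e" using i by auto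
            ultimately show False using nat_dvd_not_less by blast
          qed
          then show "fps_nth H i * \<alpha> ^ i = 0" using assms(4) by simp
        qed
        finally show ?thesis by simp
      qed
      moreover have "\<alpha> ^ n = \<alpha> ^ (n - e) * \<alpha> ^ e" using 3 by (simp flip: power_add)
      ultimately show ?thesis
        unfolding coeff using 3 assms(2) by (simp add: dvd_minus_self field_simps)
    qed
  qed
qed

text \<open>Substituting \<open>A\<close> into the factorisation of \<open>H\<close> gives
  \<open>A * (1 - A^e / \<alpha>^e) * (Q oo A)\<close>. Powers of \<open>A\<close> have nonnegative
  coefficients, so \<open>Q oo A\<close> keeps the sign pattern of \<open>Q\<close> and can be
  cancelled.\<close>

lemma fps_fixpoint_inequality:
  fixes A H :: "real fps"
  assumes e: "e \<ge> 1" and \<alpha>: "\<alpha> > 0" and A: "fps_nth A 0 = 0" "\<And>n. fps_nth A n \<ge> 0"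
    and H: "fps_nth H 0 = 1" "\<And>j. \<not> e dvd j \<Longrightarrow> fps_nth H j = 0"
    and partial: "\<And>j. j \<ge> e \<Longrightarrow> (\<Sum>i\<le>j. fps_nth H i * \<alpha> ^ i) \<le> 0"
    and le: "\<And>n. fps_nth fps_X n \<le> fps_nth ((fps_X * H) oo A) n"
  shows "fps_nth fps_X n + 1 / \<alpha> ^ e * fps_nth (A ^ Suc e) n \<le> fps_nth A n"
proof -
  let ?c = "fps_const (1 / \<alpha> ^ e)"
  obtain Q where Q: "H = (1 - ?c * fps_X ^ e) * Q" "fps_nth Q 0 = 1"
    "\<And>n. n \<ge> 1 \<Longrightarrow> fps_nth Q n \<le> 0"
    using fps_divide_by_root[OF e \<alpha> H partial] by blast
  have X: "fps_X oo A = A" using A(1) by (simp add: fps_X_fps_compose_startby0)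
  have Xe: "fps_X ^ e oo A = A ^ e" using fps_compose_power[OF A(1), of fps_X e] X by simp
  have comp: "(fps_X * H) oo A = (A * (1 - ?c * A ^ e)) * (Q oo A)"
    unfolding Q(1) using A(1) X Xe
    by (simp add: fps_compose_mult_distrib fps_compose_sub_distrib mult.assoc)
  have Q_nonpos: "fps_nth (Q oo A) n \<le> 0" if "n \<ge> 1" for n
    unfolding fps_compose_nth
  proof (rule sum_nonpos)
    fix i
    \<comment> \<open>The positive coefficient of \<open>Q\<close>, at \<open>i = 0\<close>, meets
      coefficient \<open>n \<ge> 1\<close> of \<open>A ^ 0 = 1\<close>, which is zero.\<close>
    show "fps_nth Q i * fps_nth (A ^ i) n \<le> 0"
      using that Q(3)[of i] fps_power_nonneg[OF A(2), of i n]
      by (cases "i = 0") (auto intro: mult_nonpos_nonneg)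
  qed
  have "fps_nth fps_X n \<le> fps_nth (A * (1 - ?c * A ^ e)) n"
  proof (rule fps_mult_le_one_cancel)
    show "fps_nth (Q oo A) 0 = 1" using Q(2) by simp
    show "fps_nth fps_X n \<le> fps_nth (A * (1 - ?c * A ^ e) * (Q oo A)) n" for n
      using le[of n] by (simp only: comp)
    show "0 \<le> (fps_nth fps_X n :: real)" for n by (simp add: fps_X_def)
  qed (rule Q_nonpos)
  also have "A * (1 - ?c * A ^ e) = A - ?c * A ^ Suc e"
    by (simp add: algebra_simps)
  finally show ?thesis by simp
qed

section \<open>The lower bound\<close>

lemma LT_avoiding_eq: "LT_avoiding d X P n = {t. well_formed d X t \<and> distinct (leaves t) \<and>
    set (leaves t) = {1..n} \<and> (\<forall>p\<in>P. avoids t p)}"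
  by (auto simp: LT_avoiding_def LT_n_def LT_def dest: distinct_card)

text \<open>Division by \<open>fps_X\<close> shifts the index, so patterns with \<open>Suc j\<close>
  leaves enter at \<open>j\<close>.\<close>

lemma h_series_nth:
  "fps_nth (h_series d X P) j = (if j = 0 then 1 else 0) - (if j = d - 1 then card X / fact d else 0)
     + card (P \<inter> LT_n d X (Suc j)) / fact (Suc j)"
  by (simp add: h_series_def f_series_def)

context tree_patterns
begin

lemma leaf_count_dvd: "LT_n d X (Suc j) \<noteq> {} \<Longrightarrow> (d - 1) dvd j"
  using leaf_count_cong[OF _ d1, of X] by (fastforce simp: LT_n_def LT_def)

text \<open>The one-vertex tree is never a subtree, so as a pattern it is discarded.\<close>

definition reduced_h_series :: "real fps" where
  "reduced_h_series = Abs_fps (\<lambda>j. if j = 0 then 1 else fps_nth (h_series d X P) j)"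

text \<open>Beyond \<open>d - 1\<close> all coefficients of \<open>h\<close> are nonnegative, so its
  partial sums at \<open>\<alpha>\<close> stay below the total 0. Resetting the constant term to 1
  can only lower them.\<close>

lemma reduced_h_series_partial_sums:
  assumes \<alpha>: "\<alpha> > 0" and root: "fps_root (h_series d X P) \<alpha>" and j: "j \<ge> d - 1"
  shows "(\<Sum>i\<le>j. fps_nth reduced_h_series i * \<alpha> ^ i) \<le> 0"
proof -
  have "(\<Sum>i\<le>j. fps_nth reduced_h_series i * \<alpha> ^ i) \<le> (\<Sum>i\<le>j. fps_nth (h_series d X P) i * \<alpha> ^ i)"
    using \<alpha> d by (intro sum_mono mult_right_mono) (auto simp: reduced_h_series_def h_series_nth)
  also have "\<dots> \<le> (\<Sum>i. fps_nth (h_series d X P) i * \<alpha> ^ i)"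
  proof (rule sum_le_suminf)
    show "summable (\<lambda>i. fps_nth (h_series d X P) i * \<alpha> ^ i)"
      using root by (auto simp: fps_root_def sums_iff)
    fix i assume "i \<in> - {..j}"
    then show "0 \<le> fps_nth (h_series d X P) i * \<alpha> ^ i" using j \<alpha> d by (auto simp: h_series_nth)
  qed simp
  also have "\<dots> = 0" using root by (simp add: fps_root_def sums_iff)
  finally show ?thesis .
qed

lemma tree_egf_lower:
  assumes P: "P \<subseteq> LT d X" and \<alpha>: "\<alpha> > 0" and root: "fps_root (h_series d X P) \<alpha>"
  shows "fps_nth fps_X n + 1 / \<alpha> ^ (d - 1) * fps_nth (tree_egf ^ d) n \<le> fps_nth tree_egf n"
proof -
  let ?A = tree_egf and ?H = reduced_h_series
  have A: "fps_nth ?A 0 = 0" "\<And>n. fps_nth ?A n \<ge> 0"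
    using tree_count_0 by (simp_all add: tree_egf_def)
  have "fps_nth fps_X n \<le> fps_nth ((fps_X * ?H) oo ?A) n" for n
  proof -
    \<comment> \<open>For \<open>n < d\<close> the index \<open>d\<close> falls outside the
      summation range \<open>1..n\<close>, and the missing term is zero.\<close>
    have zero: "fps_nth (?A ^ d) n = 0" if "n < d"
      using that A(1) by (auto intro: startsby_zero_power_prefix[rule_format])
    \<comment> \<open>The constant term 1 of \<open>?H\<close> yields \<open>?A\<close> itself, the
      negative term the trees with \<open>d\<close> branches, and the rest the patterns with at
      least two leaves: the terms of \<open>golod_shafarevich_egf\<close>.\<close>
    have coeff: "fps_nth (fps_X * ?H) (Suc l) * y
        = (if l = 0 then y else 0) + (if Suc l = d then - (card X / fact d) * y else 0)
          + (if l \<ge> 1 then card (P \<inter> LT_n d X (Suc l)) / fact (Suc l) * y else 0)" for l y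
      using d by (auto simp: reduced_h_series_def h_series_nth algebra_simps)
    have "fps_nth ((fps_X * ?H) oo ?A) n = (\<Sum>i=0..n. fps_nth (fps_X * ?H) i * fps_nth (?A ^ i) n)"
      by (simp add: fps_compose_nth)
    also have "\<dots> = (\<Sum>i=1..n. fps_nth (fps_X * ?H) i * fps_nth (?A ^ i) n)"
      by (rule sum.mono_neutral_right) auto
    also have "\<dots> = (\<Sum>i=1..n. (if i = 1 then fps_nth (?A ^ i) n else 0)
        + (if i = d then - (card X / fact d) * fps_nth (?A ^ i) n else 0)
        + (if i \<ge> 2 then card (P \<inter> LT_n d X i) / fact i * fps_nth (?A ^ i) n else 0))"
    proof (rule sum.cong[OF refl])
      fix i assume "i \<in> {1..n}"
      then obtain l where i: "i = Suc l" by (cases i) auto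
      show "fps_nth (fps_X * ?H) i * fps_nth (?A ^ i) n = (if i = 1 then fps_nth (?A ^ i) n else 0)
        + (if i = d then - (card X / fact d) * fps_nth (?A ^ i) n else 0)
        + (if i \<ge> 2 then card (P \<inter> LT_n d X i) / fact i * fps_nth (?A ^ i) n else 0)"
        unfolding i coeff by (simp del: power_Suc fact_Suc)
    qed
    also have "\<dots> = (\<Sum>i=1..n. if i = 1 then fps_nth (?A ^ i) n else 0)
        + (\<Sum>i=1..n. if i = d then - (card X / fact d) * fps_nth (?A ^ i) n else 0)
        + (\<Sum>i=1..n. if i \<ge> 2 then card (P \<inter> LT_n d X i) / fact i * fps_nth (?A ^ i) n else 0)"
      by (simp only: sum.distrib)
    also have "(\<Sum>i=1..n. if i = 1 then fps_nth (?A ^ i) n else 0) = fps_nth ?A n"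
      using A(1) by (cases n) simp_all
    also have "(\<Sum>i=1..n. if i = d then - (card X / fact d) * fps_nth (?A ^ i) n else 0)
        = - (card X / fact d) * fps_nth (?A ^ d) n"
      using d zero by (subst sum.delta) auto
    also have "(\<Sum>i=1..n. if i \<ge> 2 then card (P \<inter> LT_n d X i) / fact i * fps_nth (?A ^ i) n else 0)
        = (\<Sum>i=2..n. card (P \<inter> LT_n d X i) / fact i * fps_nth (?A ^ i) n)"
      by (rule sum.mono_neutral_cong_right) auto
    finally show ?thesis using golod_shafarevich_egf[OF P, of n] by simp
  qed
  moreover have "fps_nth ?H j = 0" if "\<not> (d - 1) dvd j" for j
  proof -
    have "j \<noteq> 0" using that by (metis dvd_0_right)
    moreover have "j \<noteq> d - 1" using that by (metis dvd_refl)
    moreover have "LT_n d X (Suc j) = {}" using that leaf_count_dvd by blast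
    ultimately show ?thesis by (simp add: reduced_h_series_def h_series_nth)
  qed
  moreover have "fps_nth ?H 0 = 1" by (simp add: reduced_h_series_def)
  ultimately have "fps_nth fps_X n + 1 / \<alpha> ^ (d - 1) * fps_nth (?A ^ Suc (d - 1)) n \<le> fps_nth ?A n"
    using d \<alpha> A reduced_h_series_partial_sums[OF \<alpha> root]
    by (intro fps_fixpoint_inequality[where H = ?H]) auto
  then show ?thesis using d by simp
qed

end

theorem mainTheorem4:
  fixes d n :: nat and X :: "'x set" and P :: "'x ltree set" and \<alpha> :: real
  assumes "d \<ge> 2"
    and "finite X" and "X \<noteq> {}"
    and "P \<subseteq> LT d X"
    and "\<alpha> > 0" and "fps_root (h_series d X P) \<alpha>"
    and "n \<ge> 1"
  shows "real (card (LT_avoiding d X P n)) \<ge>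
    (fact d powr (1 / real (d - 1)) / (real (card X) powr (1 / real (d - 1)) * \<alpha>)) ^ (n - 1)
      * real (card (LT_n d X n))"
proof -
  interpret av: tree_patterns d X P by unfold_locales fact+
  interpret all: tree_patterns d X "{}" by unfold_locales fact+
  \<comment> \<open>Chosen so that \<open>b_pow\<close> holds: rescaling by \<open>b\<close> turns
    the coefficient \<open>card X / fact d\<close> for all trees into the
    \<open>1 / \<alpha> ^ (d - 1)\<close> of \<open>tree_egf_lower\<close>.\<close>
  define b where "b = fact d powr (1 / real (d - 1)) / (real (card X) powr (1 / real (d - 1)) * \<alpha>)"
  have X: "card X > 0" using assms by (simp add: card_gt_0_iff)
  have b: "b > 0" using X assms by (simp add: b_def)
  have pow: "(x powr (1 / real (d - 1))) ^ (d - 1) = x" if "x > 0" for x :: real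
  proof -
    have "(x powr (1 / real (d - 1))) ^ (d - 1) = (x powr (1 / real (d - 1))) powr real (d - 1)"
      using that by (simp add: powr_realpow)
    also have "\<dots> = x" using that assms(1) by (simp add: powr_powr)
    finally show ?thesis .
  qed
  have b_pow: "b ^ (d - 1) * (card X / fact d) = 1 / \<alpha> ^ (d - 1)"
    using X by (simp only: b_def power_divide power_mult_distrib pow fact_gt_zero of_nat_0_less_iff) simp
  let ?F = all.tree_egf
  \<comment> \<open>Coefficient \<open>m \<ge> 1\<close> of \<open>B\<close> is that of
    \<open>?F\<close> times \<open>b ^ (m - 1)\<close>, the factor in the bound. The form
    \<open>b ^ m / b\<close> below covers \<open>m = 0\<close> too.\<close>
  define B where "B = fps_const (1 / b) * (?F oo (fps_const b * fps_X))"
  have B: "fps_nth B m = b ^ m / b * fps_nth ?F m" for m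
    by (simp add: B_def fps_compose_linear)
  have B_pow: "fps_nth (B ^ d) m = b ^ m / b ^ d * fps_nth (?F ^ d) m" for m
  proof -
    have "(?F oo (fps_const b * fps_X)) ^ d = ?F ^ d oo (fps_const b * fps_X)"
      by (rule fps_compose_power) simp
    then show ?thesis
      unfolding B_def power_mult_distrib fps_const_power by (simp add: fps_compose_linear power_divide)
  qed
  have B_le: "fps_nth B m \<le> fps_nth fps_X m + 1 / \<alpha> ^ (d - 1) * fps_nth (B ^ d) m" for m
  proof -
    have X_coeff: "b ^ m / b * fps_nth fps_X m = fps_nth fps_X m" using b by (simp add: fps_X_def)
    have "fps_nth B m \<le> b ^ m / b * (fps_nth fps_X m + card X / fact d * fps_nth (?F ^ d) m)"
      unfolding B using b all.tree_egf_le by (intro mult_left_mono) auto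
    also have "b ^ m / b * (fps_nth fps_X m + card X / fact d * fps_nth (?F ^ d) m)
        = fps_nth fps_X m + b ^ m / b * (card X / fact d) * fps_nth (?F ^ d) m"
      unfolding distrib_left X_coeff by simp
    \<comment> \<open>The quotient \<open>b ^ m / b ^ d\<close> keeps the splitting of the exponent
      \<open>m - 1\<close> valid for \<open>m < d\<close>.\<close>
    also have "b ^ m / b = b ^ (d - 1) * (b ^ m / b ^ d)"
      using b assms(1) by (simp add: field_simps flip: power_Suc)
    also have "\<dots> * (card X / fact d) = 1 / \<alpha> ^ (d - 1) * (b ^ m / b ^ d)"
      unfolding b_pow[symmetric] by (simp only: mult_ac)
    finally show ?thesis by (simp add: B_pow)
  qed
  have "fps_nth B n \<le> fps_nth av.tree_egf n"
  proof (rule fps_fixpoint_mono[OF assms(1) _ _ _ _ _ B_le])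
    show "fps_nth B m \<ge> 0" for m using b by (simp add: B all.tree_egf_def)
    show "fps_nth fps_X m + 1 / \<alpha> ^ (d - 1) * fps_nth (av.tree_egf ^ d) m \<le> fps_nth av.tree_egf m" for m
      using assms by (intro av.tree_egf_lower)
  qed (use assms(5) all.tree_count_0 av.tree_count_0 in \<open>simp_all add: B all.tree_egf_def av.tree_egf_def\<close>)
  moreover have "b ^ n / b = b ^ (n - 1)" using b assms(7) by (simp add: power_diff)
  \<comment> \<open>Both coefficients carry the factor \<open>1 / fact n\<close>, which
    cancels.\<close>
  ultimately have "b ^ (n - 1) * all.tree_count n \<le> av.tree_count n"
    by (simp add: B all.tree_egf_def av.tree_egf_def divide_right_mono divide_le_cancel)
  moreover have "LT_n d X n = LT_avoiding d X {} n" by (simp add: LT_avoiding_def)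
  ultimately show ?thesis
    by (simp add: LT_avoiding_eq all.tree_count_def av.tree_count_def all.trees_def av.trees_def b_def)
qed

end
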